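(* For every integer $n\ge 0$, $$\sum_{k=0}^{n}x^{k}\,T_{n,k}(1,1,\dots,1)=B_n^{(c)}(x).$$
   Context: All generating functions are formal power series in $t$; $x,x_1,x_2,\dots$ are indeterminates (or real numbers). The central incomplete Bell polynomials $T_{n,k}(x_1,\dots,x_{n-k+1})$ ($n\ge k\ge 0$) are defined, for each $k\ge 0$, by $$\frac{1}{k!}\Big(\sum_{m=1}^\infty \frac{1}{2^m}\big(x_m-(-1)^m x_m\big)\frac{t^m}{m!}\Big)^k=\sum_{n=k}^\infty T_{n,k}(x_1,x_2,\dots,x_{n-k+1})\frac{t^n}{n!},$$ and $T_{n,k}(1,\dots,1)$ is the value at $x_m=1$ for all $m$. The central factorial numbers of the second kind $T(n,k)$ are defined, for each $k\ge 0$, by $$\frac{1}{k!}\big(e^{t/2}-e^{-t/2}\big)^k=\sum_{n=k}^\infty T(n,k)\frac{t^n}{n!}.$$ The central Bell polynomials are $B_n^{(c)}(x)=\sum_{k=0}^n T(n,k)x^k$ ($n\ge 0$). *)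

theory Defs
  imports "HOL-Computational_Algebra.Formal_Power_Series"
begin

(* A sequence x :: nat => 'a stands for (x_1, x_2, ...); its entry x 0 is never used.
   The scalars range over an arbitrary field of characteristic 0, which covers real numbers
   as well as indeterminates (elements of a field of rational functions). *)

definition odd_part_egf :: "(nat \<Rightarrow> 'a::field_char_0) \<Rightarrow> 'a fps" where
  "odd_part_egf x =
     Abs_fps (\<lambda>m. if m = 0 then 0 else 1 / 2 ^ m * (x m - (- 1) ^ m * x m) / fact m)"

(* T_{n,k}(x_1, x_2, ...), read off from its exponential generating function.  The whole sequence
   is passed; only x_1, ..., x_{n-k+1} matter, see central_bell_incomplete_cong below. *)
definition central_bell_incomplete :: "nat \<Rightarrow> nat \<Rightarrow> (nat \<Rightarrow> 'a::field_char_0) \<Rightarrow> 'a" where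
  "central_bell_incomplete n k x =
     fact n * fps_nth (fps_const (1 / fact k) * odd_part_egf x ^ k) n"

(* T(n,k); here fps_exp c is the series of e^{c t}. *)
definition central_factorial :: "nat \<Rightarrow> nat \<Rightarrow> 'a::field_char_0" where
  "central_factorial n k =
     fact n * fps_nth (fps_const (1 / fact k) * (fps_exp (1 / 2) - fps_exp (- 1 / 2)) ^ k) n"

definition central_bell_poly :: "nat \<Rightarrow> 'a::field_char_0 \<Rightarrow> 'a" where
  "central_bell_poly n x = (\<Sum>k\<le>n. central_factorial n k * x ^ k)"

(* The two generating series start at n = k, so the definitions above agree with
   the defining identities, whose right-hand sides are sums over n >= k. *)

lemma fps_pow_nth_eq_0:
  fixes f :: "'a::field_char_0 fps"
  assumes "fps_nth f 0 = 0" "n < k"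
  shows "fps_nth (f ^ k) n = 0"
  using assms startsby_zero_power_prefix[of f k] by auto

lemma central_bell_incomplete_egf:
  "fps_const (1 / fact k) * odd_part_egf x ^ k =
     Abs_fps (\<lambda>n. if n < k then 0 else central_bell_incomplete n k x / fact n)"
proof (rule fps_ext)
  fix n
  have "fps_nth (odd_part_egf x) 0 = 0" by (simp add: odd_part_egf_def)
  from fps_pow_nth_eq_0[OF this, of n k]
  show "fps_nth (fps_const (1 / fact k) * odd_part_egf x ^ k) n =
      fps_nth (Abs_fps (\<lambda>n. if n < k then 0 else central_bell_incomplete n k x / fact n)) n"
    by (simp add: central_bell_incomplete_def)
qed

lemma central_factorial_egf:
  "fps_const (1 / fact k) * (fps_exp (1 / 2) - fps_exp (- 1 / 2)) ^ k =
     Abs_fps (\<lambda>n. if n < k then 0 else central_factorial n k / (fact n :: 'a::field_char_0))"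
proof (rule fps_ext)
  fix n
  have "fps_nth (fps_exp (1 / 2) - fps_exp (- 1 / 2) :: 'a fps) 0 = 0" by simp
  from fps_pow_nth_eq_0[OF this, of n k]
  show "fps_nth (fps_const (1 / fact k) * (fps_exp (1 / 2) - fps_exp (- 1 / 2)) ^ k) n =
      fps_nth (Abs_fps (\<lambda>n. if n < k then 0 else central_factorial n k / (fact n :: 'a))) n"
    by (simp add: central_factorial_def)
qed

lemma fps_pow_nth_cong:
  fixes f g :: "'a::field_char_0 fps"
  assumes f0: "fps_nth f 0 = 0" and g0: "fps_nth g 0 = 0"
    and "k \<le> n" "\<And>m. m \<le> n - k + 1 \<Longrightarrow> fps_nth f m = fps_nth g m"
  shows "fps_nth (f ^ k) n = fps_nth (g ^ k) n"
  using assms(3,4)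
proof (induction k arbitrary: n)
  case (Suc k)
  have "fps_nth f i * fps_nth (f ^ k) (n - i) = fps_nth g i * fps_nth (g ^ k) (n - i)"
    if "i \<le> n" for i
  proof (cases "i = 0 \<or> n - i < k")
    case True
    then show ?thesis using f0 g0 fps_pow_nth_eq_0[OF f0, of "n - i" k]
        fps_pow_nth_eq_0[OF g0, of "n - i" k] by auto
  next
    case False
    then have "fps_nth (f ^ k) (n - i) = fps_nth (g ^ k) (n - i)"
      using Suc.prems by (intro Suc.IH) auto
    moreover have "fps_nth f i = fps_nth g i"
      using False that Suc.prems(1) by (intro Suc.prems(2)) linarith
    ultimately show ?thesis by simp
  qed
  then show ?case by (simp add: fps_mult_nth)
qed simp

lemma central_bell_incomplete_cong:
  assumes "k \<le> n" "\<And>m. 1 \<le> m \<Longrightarrow> m \<le> n - k + 1 \<Longrightarrow> x m = y m"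
  shows "central_bell_incomplete n k x = central_bell_incomplete n k y"
proof -
  have "fps_nth (odd_part_egf x ^ k) n = fps_nth (odd_part_egf y ^ k) n"
    using assms by (intro fps_pow_nth_cong) (auto simp: odd_part_egf_def)
  then show ?thesis by (simp add: central_bell_incomplete_def)
qed

end

theory Submission
  imports Defs
begin

text \<open>When every x_m is 1, the series whose k-th powers generate T_{n,k} collapses to e^{t/2}
  - e^{-t/2} (\<open>odd_part_egf_one\<close>). Hence T_{n,k}(1,...,1) = T(n,k), and the two sums
  agree term by term.\<close>

lemma odd_part_egf_one:
  "odd_part_egf (\<lambda>_. 1) = (fps_exp (1 / 2) - fps_exp (- 1 / 2) :: 'a::field_char_0 fps)"
proof (rule fps_ext)
  fix m
  \<comment> \<open>With the sign split off, both coefficients read (1 - (-1)^m) / (2^m m!); at m =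
    0 this vanishes, matching the separate case in \<open>odd_part_egf\<close>.\<close>
  have "(- 1 / 2 :: 'a) ^ m = (- 1) ^ m / 2 ^ m"
    by (rule power_divide)
  then show "fps_nth (odd_part_egf (\<lambda>_. 1)) m =
      fps_nth (fps_exp (1 / 2) - fps_exp (- 1 / 2) :: 'a fps) m"
    by (simp add: odd_part_egf_def power_one_over diff_divide_distrib)
qed

lemma central_bell_incomplete_one:
  "central_bell_incomplete n k (\<lambda>_. 1) = central_factorial n k"
  by (simp only: central_bell_incomplete_def central_factorial_def odd_part_egf_one)

theorem theorem2p5:
  fixes x :: "'a::field_char_0" and n :: nat
  shows "(\<Sum>k\<le>n. x ^ k * central_bell_incomplete n k (\<lambda>_. 1)) = central_bell_poly n x"
  by (simp add: central_bell_poly_def central_bell_incomplete_one mult.commute)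

end
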